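(* Let $n>0$ be an integer. If $\lambda\in\Omega_2(n)$, then $\lambda$ has at most $\lceil \frac{n}{2}\rceil$ parts.
   Context: For a positive integer $n$, $\mathcal{P}(n)$ is the set of partitions of $n$, and for $\lambda\in\mathcal{P}(n)$, $\chi^\lambda$ is the irreducible complex character of the symmetric group $S_n$ labelled by $\lambda$ (the character of the Specht module $S^\lambda$; $\chi^{(n)}$ is the trivial character). Let $P_n$ be a Sylow $2$-subgroup of $S_n$. Then $\Omega_2(n)$ is the set of $\lambda\in\mathcal{P}(n)$ such that $\chi^\lambda$ is an irreducible constituent of the induced character $(1_{P_n})\uparrow^{S_n}$ (this does not depend on the choice of $P_n$). *)

theory Defs
  imports
    Complex_Main
    "HOL-Library.Function_Algebras"
    "HOL-Computational_Algebra.Primes"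
    "HOL-Combinatorics.Permutations"
    "HOL-Algebra.Sym_Groups"
begin

section \<open>Complex representations and characters of groups\<close>

text \<open>All vector spaces are subspaces of some function space \<^typ>\<open>'x \<Rightarrow> complex\<close> with the
  pointwise operations.\<close>

definition scale_fun :: "complex \<Rightarrow> ('x \<Rightarrow> complex) \<Rightarrow> 'x \<Rightarrow> complex" where
  "scale_fun c f = (\<lambda>x. c * f x)"

interpretation fun_space: vector_space "scale_fun :: complex \<Rightarrow> ('x \<Rightarrow> complex) \<Rightarrow> 'x \<Rightarrow> complex"
  by unfold_locales (auto simp: scale_fun_def algebra_simps)

definition linear_on :: "('x \<Rightarrow> complex) set \<Rightarrow> (('x \<Rightarrow> complex) \<Rightarrow> 'x \<Rightarrow> complex) \<Rightarrow> bool" where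
  "linear_on V T \<longleftrightarrow>
     (\<forall>v\<in>V. \<forall>w\<in>V. T (v + w) = T v + T w) \<and>
     (\<forall>c. \<forall>v\<in>V. T (scale_fun c v) = scale_fun c (T v))"

text \<open>The trace of an endomorphism of a finite-dimensional \<open>V\<close>: the sum of the diagonal entries
  of its matrix with respect to a basis. The basis is chosen arbitrarily, as the trace does not
  depend on it.\<close>

definition trace_on :: "('x \<Rightarrow> complex) set \<Rightarrow> (('x \<Rightarrow> complex) \<Rightarrow> 'x \<Rightarrow> complex) \<Rightarrow> complex" where
  "trace_on V T =
     (let B = (SOME B. fun_space.independent B \<and> fun_space.span B = V)
      in \<Sum>b\<in>B. fun_space.representation B (T b) b)"

text \<open>Only the values \<open>\<rho> g v\<close> with \<open>g \<in> carrier G\<close> and \<open>v \<in> V\<close> are relevant.\<close>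

definition representation_of ::
  "('g, 'm) monoid_scheme \<Rightarrow> ('x \<Rightarrow> complex) set \<Rightarrow>
   ('g \<Rightarrow> ('x \<Rightarrow> complex) \<Rightarrow> 'x \<Rightarrow> complex) \<Rightarrow> bool" where
  "representation_of G V \<rho> \<longleftrightarrow>
     fun_space.subspace V \<and>
     (\<exists>B. finite B \<and> fun_space.span B = V) \<and>
     (\<forall>g\<in>carrier G. linear_on V (\<rho> g) \<and> \<rho> g ` V \<subseteq> V) \<and>
     (\<forall>v\<in>V. \<rho> \<one>\<^bsub>G\<^esub> v = v) \<and>
     (\<forall>g\<in>carrier G. \<forall>h\<in>carrier G. \<forall>v\<in>V. \<rho> (g \<otimes>\<^bsub>G\<^esub> h) v = \<rho> g (\<rho> h v))"

definition irreducible_representation_of ::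
  "('g, 'm) monoid_scheme \<Rightarrow> ('x \<Rightarrow> complex) set \<Rightarrow>
   ('g \<Rightarrow> ('x \<Rightarrow> complex) \<Rightarrow> 'x \<Rightarrow> complex) \<Rightarrow> bool" where
  "irreducible_representation_of G V \<rho> \<longleftrightarrow>
     representation_of G V \<rho> \<and> V \<noteq> {0} \<and>
     (\<forall>U. fun_space.subspace U \<and> U \<subseteq> V \<and> (\<forall>g\<in>carrier G. \<rho> g ` U \<subseteq> U) \<longrightarrow> U = {0} \<or> U = V)"

definition rep_char ::
  "('x \<Rightarrow> complex) set \<Rightarrow> ('g \<Rightarrow> ('x \<Rightarrow> complex) \<Rightarrow> 'x \<Rightarrow> complex) \<Rightarrow> 'g \<Rightarrow> complex" where
  "rep_char V \<rho> g = trace_on V (\<rho> g)"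

text \<open>Characters are only compared on \<open>carrier G\<close>. Every finite-dimensional space embeds into
  \<^typ>\<open>nat \<Rightarrow> complex\<close>, so restricting the existential quantifiers below to representations on
  subspaces of that space loses nothing. The zero space is allowed as a representation, so the
  zero function counts as a character (but not as an irreducible one).\<close>

definition is_character :: "('g, 'm) monoid_scheme \<Rightarrow> ('g \<Rightarrow> complex) \<Rightarrow> bool" where
  "is_character G \<chi> \<longleftrightarrow>
     (\<exists>(V :: (nat \<Rightarrow> complex) set) \<rho>.
        representation_of G V \<rho> \<and> (\<forall>g\<in>carrier G. \<chi> g = rep_char V \<rho> g))"

definition is_irreducible_character :: "('g, 'm) monoid_scheme \<Rightarrow> ('g \<Rightarrow> complex) \<Rightarrow> bool" where
  "is_irreducible_character G \<chi> \<longleftrightarrow>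
     (\<exists>(V :: (nat \<Rightarrow> complex) set) \<rho>.
        irreducible_representation_of G V \<rho> \<and> (\<forall>g\<in>carrier G. \<chi> g = rep_char V \<rho> g))"

text \<open>\<open>\<chi>\<close> is an irreducible constituent of the character \<open>\<psi>\<close> if it occurs in a decomposition of
  \<open>\<psi>\<close> as a sum of irreducible characters; \<open>\<theta>\<close> is the sum of the other terms, possibly zero.\<close>

definition irreducible_constituent ::
  "('g, 'm) monoid_scheme \<Rightarrow> ('g \<Rightarrow> complex) \<Rightarrow> ('g \<Rightarrow> complex) \<Rightarrow> bool" where
  "irreducible_constituent G \<chi> \<psi> \<longleftrightarrow>
     is_irreducible_character G \<chi> \<and>
     (\<exists>\<theta>. is_character G \<theta> \<and> (\<forall>g\<in>carrier G. \<psi> g = \<chi> g + \<theta> g))"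

definition induced_char ::
  "('g, 'm) monoid_scheme \<Rightarrow> 'g set \<Rightarrow> ('g \<Rightarrow> complex) \<Rightarrow> 'g \<Rightarrow> complex" where
  "induced_char G H \<phi> g =
     (\<Sum>x\<in>carrier G. if inv\<^bsub>G\<^esub> x \<otimes>\<^bsub>G\<^esub> g \<otimes>\<^bsub>G\<^esub> x \<in> H
        then \<phi> (inv\<^bsub>G\<^esub> x \<otimes>\<^bsub>G\<^esub> g \<otimes>\<^bsub>G\<^esub> x) else 0) / of_nat (card H)"

definition sylow_subgroup :: "nat \<Rightarrow> 'g set \<Rightarrow> ('g, 'm) monoid_scheme \<Rightarrow> bool" where
  "sylow_subgroup p P G \<longleftrightarrow> subgroup P G \<and> card P = p ^ multiplicity p (order G)"


section \<open>Partitions and Specht modules\<close>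

text \<open>A partition is the weakly decreasing list of its parts, all of them positive.\<close>

definition partitions :: "nat \<Rightarrow> nat list set" where
  "partitions n = {\<mu>. sorted_wrt (\<ge>) \<mu> \<and> 0 \<notin> set \<mu> \<and> sum_list \<mu> = n}"

text \<open>Rows and columns are numbered from 0; the cell in row \<open>i\<close> and column \<open>j\<close> is \<open>(i, j)\<close>.\<close>

definition diagram :: "nat list \<Rightarrow> (nat \<times> nat) set" where
  "diagram \<mu> = {(i, j). i < length \<mu> \<and> j < \<mu> ! i}"

text \<open>The values of a tableau outside the diagram are irrelevant.\<close>

definition tableaux :: "nat list \<Rightarrow> (nat \<times> nat \<Rightarrow> nat) set" where
  "tableaux \<mu> = {t. bij_betw t (diagram \<mu>) {1..sum_list \<mu>}}"

definition row_entries :: "nat list \<Rightarrow> (nat \<times> nat \<Rightarrow> nat) \<Rightarrow> nat \<Rightarrow> nat set" where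
  "row_entries \<mu> t i = t ` {c \<in> diagram \<mu>. fst c = i}"

definition col_entries :: "nat list \<Rightarrow> (nat \<times> nat \<Rightarrow> nat) \<Rightarrow> nat \<Rightarrow> nat set" where
  "col_entries \<mu> t j = t ` {c \<in> diagram \<mu>. snd c = j}"

text \<open>The tabloid of a tableau is its class under permuting the entries within each row. It is
  encoded as the family of the sets of entries of the rows, and the permutation module is the
  space of functions on such families that vanish off the tabloids. A permutation \<open>\<sigma>\<close> sends the
  family \<open>T\<close> to \<open>\<lambda>i. \<sigma> ` T i\<close>, hence the basis vector of a tabloid to that of its image under \<open>\<sigma>\<close>;
  on functions this is the operation \<open>perm_act\<close>.\<close>

type_synonym tabloid = "nat \<Rightarrow> nat set"

definition tabloid_vec :: "tabloid \<Rightarrow> tabloid \<Rightarrow> complex" where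
  "tabloid_vec T = (\<lambda>X. if X = T then 1 else 0)"

definition perm_act :: "(nat \<Rightarrow> nat) \<Rightarrow> (tabloid \<Rightarrow> complex) \<Rightarrow> tabloid \<Rightarrow> complex" where
  "perm_act \<sigma> f = (\<lambda>T. f (\<lambda>i. inv' \<sigma> ` T i))"

definition column_stabilizer :: "nat list \<Rightarrow> (nat \<times> nat \<Rightarrow> nat) \<Rightarrow> (nat \<Rightarrow> nat) set" where
  "column_stabilizer \<mu> t =
     {\<pi>. \<pi> permutes {1..sum_list \<mu>} \<and> (\<forall>j. \<pi> ` col_entries \<mu> t j = col_entries \<mu> t j)}"

definition polytabloid :: "nat list \<Rightarrow> (nat \<times> nat \<Rightarrow> nat) \<Rightarrow> tabloid \<Rightarrow> complex" where
  "polytabloid \<mu> t =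
     (\<Sum>\<pi>\<in>column_stabilizer \<mu> t.
        scale_fun (of_int (sign \<pi>)) (tabloid_vec (row_entries \<mu> (\<pi> \<circ> t))))"

definition specht :: "nat list \<Rightarrow> (tabloid \<Rightarrow> complex) set" where
  "specht \<mu> = fun_space.span (polytabloid \<mu> ` tableaux \<mu>)"

definition specht_char :: "nat list \<Rightarrow> (nat \<Rightarrow> nat) \<Rightarrow> complex" where
  "specht_char \<mu> = rep_char (specht \<mu>) perm_act"

text \<open>The set \<open>\<Omega>\<^sub>2(n)\<close>, computed with the Sylow 2-subgroup \<open>P\<close> of the symmetric group on
  \<open>{1..n}\<close>.\<close>

definition Omega2 :: "nat \<Rightarrow> (nat \<Rightarrow> nat) set \<Rightarrow> nat list set" where
  "Omega2 n P =
     {\<mu> \<in> partitions n.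
        irreducible_constituent (sym_group n) (specht_char \<mu>)
          (induced_char (sym_group n) P (\<lambda>_. 1))}"

end

theory Submission
  imports Defs
begin

text \<open>Let \<open>t\<close> be a tableau of shape \<open>\<mu>\<close>, let \<open>C\<close> be the set of entries of its first column, so that
  \<open>card C\<close> is the number of parts of \<open>\<mu>\<close>, and consider the element
  \<open>a = (\<Sum>\<pi>\<in>Sym(C). sgn(\<pi>) \<pi>)\<close>
  of the group algebra of the symmetric group. The proof compares the values that the characters
  in question take at \<open>a\<close>.

  Divided by the order of \<open>Sym(C)\<close>, the element \<open>a\<close> becomes idempotent, and the trace of an
  idempotent is its rank. Hence every character takes a nonnegative value at \<open>a\<close>
  (\<open>sum_twisted_character\<close>). For the Specht module the value is positive, because every
  \<open>\<pi>\<close> in \<open>Sym(C)\<close> multiplies the nonzero polytabloid of \<open>t\<close> by its sign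
  (\<open>perm_act_polytabloid_column_stabilizer\<close>, \<open>polytabloid_nonzero\<close>). A character that contains the
  Specht character as a constituent is therefore positive at \<open>a\<close>.

  On the other hand, suppose that \<open>C\<close> has more than \<open>\<lceil>n/2\<rceil>\<close> elements. The value of the induced
  character at \<open>a\<close> is a combination of the sums of signs over the groups \<open>Sym(C) \<inter> x P x\<^sup>-\<^sup>1\<close>.
  The group \<open>P\<close> contains a conjugate of the 2-group generated by the disjoint transpositions
  \<open>(1 2), (3 4), \<dots>\<close>: an odd number of cosets of \<open>P\<close> is permuted by commuting involutions, so some
  coset is fixed by all of them (\<open>commuting_involutions_conjugate_into_sylow\<close>). By the pigeonhole
  principle \<open>C\<close> contains both points moved by one of the transpositions in \<open>x P x\<^sup>-\<^sup>1\<close>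
  (\<open>sylow_conjugate_contains_transposition\<close>). Thus each of these groups contains an odd
  permutation, all the sums of signs vanish, and the induced character is 0 at \<open>a\<close>. So the Specht
  character is not one of its constituents.\<close>

section \<open>Traces of idempotents and sign-twisted averages\<close>

lemma linear_on_sum:
  assumes V: "fun_space.subspace V" and T: "linear_on V T"
    and f: "\<And>i. i \<in> I \<Longrightarrow> f i \<in> V"
  shows "T (\<Sum>i\<in>I. f i) = (\<Sum>i\<in>I. T (f i))"
proof -
  have T0: "T 0 = 0"
  proof -
    have "T (scale_fun 0 0) = scale_fun 0 (T 0)"
      using T fun_space.subspace_0[OF V] unfolding linear_on_def by blast
    then show ?thesis by simp
  qed
  show ?thesis
    using f
  proof (induction I rule: infinite_finite_induct)
    case (insert i I)
    have "T (f i + (\<Sum>i\<in>I. f i)) = T (f i) + T (\<Sum>i\<in>I. f i)"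
      using T insert.prems fun_space.subspace_sum[OF V, of I f] unfolding linear_on_def by simp
    moreover have "sum f (insert i I) = f i + sum f I"
      "(\<Sum>i\<in>insert i I. T (f i)) = T (f i) + (\<Sum>i\<in>I. T (f i))"
      by (rule sum.insert[OF insert.hyps])+
    ultimately show ?case using insert.IH insert.prems by (metis insertI2)
  qed (simp_all add: T0)
qed

lemma finite_independent_of_finite_span:
  assumes "finite F" "V \<subseteq> fun_space.span F" "fun_space.independent B" "B \<subseteq> V"
  shows "finite B"
  using fun_space.independent_span_bound[of F B] assms by blast

text \<open>Expanding the vectors of each basis in terms of the other one turns both traces into the
  same double sum. This makes it legitimate to compute \<^const>\<open>trace_on\<close> in a basis adapted to
  the operator.\<close>

lemma trace_basis_independent:
  assumes V: "fun_space.subspace V" and T: "linear_on V T" "T ` V \<subseteq> V"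
    and B: "finite B" "fun_space.independent B" "fun_space.span B = V"
    and C: "finite C" "fun_space.independent C" "fun_space.span C = V"
  shows "(\<Sum>b\<in>B. fun_space.representation B (T b) b) =
         (\<Sum>c\<in>C. fun_space.representation C (T c) c)"
proof -
  let ?B = "fun_space.representation B" and ?C = "fun_space.representation C"
  have BV: "b \<in> V" if "b \<in> B" for b using that B(3) fun_space.span_base by blast
  have CV: "c \<in> V" if "c \<in> C" for c using that C(3) fun_space.span_base by blast
  have TV: "T v \<in> V" if "v \<in> V" for v using that T(2) by blast
  have 1: "?B (T b) b = (\<Sum>c\<in>C. ?C (T b) c * ?B c b)" if b: "b \<in> B" for b
  proof -
    have "T b = (\<Sum>c\<in>C. scale_fun (?C (T b) c) c)"
      using fun_space.sum_representation_eq[OF C(2), of "T b" C] C TV[OF BV[OF b]] by simp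
    then have "?B (T b) = ?B (\<Sum>c\<in>C. scale_fun (?C (T b) c) c)" by simp
    also have "\<dots> = (\<lambda>x. \<Sum>c\<in>C. ?B (scale_fun (?C (T b) c) c) x)"
      by (rule fun_space.representation_sum[OF B(2)])
        (use B(3) CV fun_space.subspace_scale[OF V] in blast)
    finally show ?thesis
      using fun_space.representation_scale[OF B(2)] B(3) CV by simp
  qed
  have 2: "?C (T c) c = (\<Sum>b\<in>B. ?B c b * ?C (T b) c)" if c: "c \<in> C" for c
  proof -
    have "c = (\<Sum>b\<in>B. scale_fun (?B c b) b)"
      using fun_space.sum_representation_eq[OF B(2), of c B] B CV[OF c] by simp
    then have "T c = T (\<Sum>b\<in>B. scale_fun (?B c b) b)" by simp
    also have "\<dots> = (\<Sum>b\<in>B. T (scale_fun (?B c b) b))"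
      by (rule linear_on_sum[OF V T(1)]) (use BV fun_space.subspace_scale[OF V] in blast)
    also have "\<dots> = (\<Sum>b\<in>B. scale_fun (?B c b) (T b))"
      using T(1) BV unfolding linear_on_def by (intro sum.cong) auto
    finally have "?C (T c) = ?C (\<Sum>b\<in>B. scale_fun (?B c b) (T b))" by simp
    also have "\<dots> = (\<lambda>x. \<Sum>b\<in>B. ?C (scale_fun (?B c b) (T b)) x)"
      by (rule fun_space.representation_sum[OF C(2)])
        (use C(3) BV TV fun_space.subspace_scale[OF V] in blast)
    finally show ?thesis
      using fun_space.representation_scale[OF C(2)] C(3) BV TV by simp
  qed
  have "(\<Sum>b\<in>B. ?B (T b) b) = (\<Sum>b\<in>B. \<Sum>c\<in>C. ?C (T b) c * ?B c b)"
    by (rule sum.cong[OF refl 1])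
  also have "\<dots> = (\<Sum>c\<in>C. \<Sum>b\<in>B. ?B c b * ?C (T b) c)"
    by (subst sum.swap) (simp only: mult.commute)
  also have "\<dots> = (\<Sum>c\<in>C. ?C (T c) c)"
    by (rule sum.cong[OF refl 2[symmetric]])
  finally show ?thesis .
qed

lemma trace_on_eq:
  assumes V: "fun_space.subspace V" and T: "linear_on V T" "T ` V \<subseteq> V"
    and B: "finite B" "fun_space.independent B" "fun_space.span B = V"
  shows "trace_on V T = (\<Sum>b\<in>B. fun_space.representation B (T b) b)"
proof -
  define C where "C = (SOME B. fun_space.independent B \<and> fun_space.span B = V)"
  have C: "fun_space.independent C \<and> fun_space.span C = V"
    using B(2,3) someI[of "\<lambda>B. fun_space.independent B \<and> fun_space.span B = V" B]
    unfolding C_def by simp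
  have "finite C"
    using finite_independent_of_finite_span[OF B(1), of V C] B(3) C fun_space.span_superset[of C]
    by simp
  with C show ?thesis
    unfolding trace_on_def Let_def C_def[symmetric]
    using trace_basis_independent[OF V T B] by simp
qed

lemma trace_on_linear_combination:
  assumes V: "fun_space.subspace V" "finite F" "fun_space.span F = V"
    and \<rho>: "\<And>h v. h \<in> H \<Longrightarrow> v \<in> V \<Longrightarrow> \<rho> h v \<in> V"
  shows "trace_on V (\<lambda>v. \<Sum>h\<in>H. scale_fun (c h) (\<rho> h v)) = (\<Sum>h\<in>H. c h * trace_on V (\<rho> h))"
proof -
  define B where "B = (SOME B. fun_space.independent B \<and> fun_space.span B = V)"
  obtain B' where "B' \<subseteq> V" "fun_space.independent B'" "V \<subseteq> fun_space.span B'"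
    using fun_space.maximal_independent_subset by blast
  then have "fun_space.independent B' \<and> fun_space.span B' = V"
    using fun_space.span_minimal[OF _ V(1)] by blast
  then have B: "fun_space.independent B" "fun_space.span B = V"
    using someI[of "\<lambda>B. fun_space.independent B \<and> fun_space.span B = V" B']
    unfolding B_def by simp_all
  have BV: "b \<in> V" if "b \<in> B" for b using that B(2) fun_space.span_base by blast
  have 1: "fun_space.representation B (\<Sum>h\<in>H. scale_fun (c h) (\<rho> h b)) b =
        (\<Sum>h\<in>H. c h * fun_space.representation B (\<rho> h b) b)" if b: "b \<in> B" for b
  proof -
    have "fun_space.representation B (\<Sum>h\<in>H. scale_fun (c h) (\<rho> h b)) =
      (\<lambda>x. \<Sum>h\<in>H. fun_space.representation B (scale_fun (c h) (\<rho> h b)) x)"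
      by (rule fun_space.representation_sum[OF B(1)])
        (use B(2) BV[OF b] \<rho> fun_space.subspace_scale[OF V(1)] in blast)
    then show ?thesis
      using fun_space.representation_scale[OF B(1)] B(2) BV[OF b] \<rho> by simp
  qed
  have "(\<Sum>b\<in>B. fun_space.representation B (\<Sum>h\<in>H. scale_fun (c h) (\<rho> h b)) b) =
        (\<Sum>b\<in>B. \<Sum>h\<in>H. c h * fun_space.representation B (\<rho> h b) b)"
    by (rule sum.cong[OF refl 1])
  also have "\<dots> = (\<Sum>h\<in>H. c h * (\<Sum>b\<in>B. fun_space.representation B (\<rho> h b) b))"
    by (subst sum.swap) (simp only: sum_distrib_left)
  finally show ?thesis
    unfolding trace_on_def Let_def B_def[symmetric] .
qed

text \<open>Extend a basis of the image to a basis of the whole space. The idempotent fixes the former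
  vectors, and it sends every other basis vector into the span of the former ones, so only the
  basis of the image contributes to the trace.\<close>

lemma trace_on_idempotent:
  assumes V: "fun_space.subspace V" "finite F" "fun_space.span F = V"
    and T: "linear_on V T" "T ` V \<subseteq> V"
    and idem: "\<And>v. v \<in> V \<Longrightarrow> T (T v) = T v"
  shows "\<exists>m::nat. trace_on V T = of_nat m \<and> ((\<exists>v\<in>V. v \<noteq> 0 \<and> T v = v) \<longrightarrow> m > 0)"
proof -
  obtain W where W: "W \<subseteq> T ` V" "fun_space.independent W" "T ` V \<subseteq> fun_space.span W"
    using fun_space.maximal_independent_subset by blast
  have "W \<subseteq> V" using W(1) T(2) by blast
  then obtain B where B: "W \<subseteq> B" "B \<subseteq> V" "fun_space.independent B" "V \<subseteq> fun_space.span B"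
    using fun_space.maximal_independent_subset_extend[OF _ W(2)] by blast
  have sB: "fun_space.span B = V"
    using B fun_space.span_minimal[OF _ V(1)] by blast
  have fB: "finite B"
    by (rule finite_independent_of_finite_span[OF V(2) _ B(3,2)]) (simp add: V(3))
  have "fun_space.representation B (T b) b = (if b \<in> W then 1 else 0)" if b: "b \<in> B" for b
  proof (cases "b \<in> W")
    case True
    then obtain v where "v \<in> V" "b = T v" using W(1) by blast
    then have "T b = b" using idem by simp
    then show ?thesis
      using True fun_space.representation_basis[OF B(3) b] by simp
  next
    case False
    have "T b \<in> fun_space.span W" using W(3) b B(2) by blast
    then have "fun_space.representation B (T b) = fun_space.representation W (T b)"
      using fun_space.representation_extend[OF B(3) _ B(1)] by blast
    then show ?thesis
      using False fun_space.representation_ne_zero[of W "T b" b] by auto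
  qed
  then have "trace_on V T = (\<Sum>b\<in>B. if b \<in> W then 1 else 0)"
    using trace_on_eq[OF V(1) T fB B(3) sB] by (simp cong: sum.cong)
  also have "\<dots> = of_nat (card W)"
    using fB B(1) by (simp add: sum.If_cases Int_absorb1)
  finally have tr: "trace_on V T = of_nat (card W)" .
  have "card W > 0" if v: "v \<in> V" "v \<noteq> 0" "T v = v" for v
  proof -
    have "v \<in> fun_space.span W" using v W(3) by (metis imageI subsetD)
    then have "W \<noteq> {}" using v(2) by auto
    then show ?thesis using fB B(1) finite_subset card_gt_0_iff by blast
  qed
  with tr show ?thesis by blast
qed

text \<open>Up to the factor \<open>card H\<close> the sum is the trace of the projection onto the vectors on which
  \<open>H\<close> acts through the inverse of the linear character \<open>\<epsilon>\<close>, so it counts the dimension of that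
  space.\<close>

lemma sum_twisted_character:
  fixes \<epsilon> :: "'g \<Rightarrow> complex"
  assumes rep: "representation_of G V \<rho>" and G: "group G"
    and H: "subgroup H G" "finite H"
    and \<epsilon>: "\<And>g h. g \<in> H \<Longrightarrow> h \<in> H \<Longrightarrow> \<epsilon> (g \<otimes>\<^bsub>G\<^esub> h) = \<epsilon> g * \<epsilon> h"
  shows "\<exists>m::nat. (\<Sum>h\<in>H. \<epsilon> h * rep_char V \<rho> h) = of_nat (card H) * of_nat m \<and>
           ((\<exists>v\<in>V. v \<noteq> 0 \<and> (\<forall>h\<in>H. scale_fun (\<epsilon> h) (\<rho> h v) = v)) \<longrightarrow> m > 0)"
proof -
  interpret group G by fact
  interpret H: subgroup H G by fact
  have V: "fun_space.subspace V" using rep unfolding representation_of_def by blast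
  obtain F where F: "finite F" "fun_space.span F = V"
    using rep unfolding representation_of_def by blast
  have lin: "linear_on V (\<rho> h)" and inV: "v \<in> V \<Longrightarrow> \<rho> h v \<in> V" if "h \<in> H" for h v
    using rep that H.subset unfolding representation_of_def by blast+
  have hom: "\<rho> (g \<otimes>\<^bsub>G\<^esub> h) v = \<rho> g (\<rho> h v)" if "g \<in> H" "h \<in> H" "v \<in> V" for g h v
    using rep that H.subset unfolding representation_of_def by blast
  define N where "N = (of_nat (card H) :: complex)"
  have "card H > 0" using H(2) H.one_closed card_gt_0_iff by blast
  then have N0: "N \<noteq> 0" unfolding N_def by simp
  define S where "S v = (\<Sum>h\<in>H. scale_fun (\<epsilon> h) (\<rho> h v))" for v
  define E where "E v = (\<Sum>h\<in>H. scale_fun (\<epsilon> h / N) (\<rho> h v))" for v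
  have ES: "E v = scale_fun (1 / N) (S v)" for v
    unfolding E_def S_def by (simp add: fun_space.scale_sum_right)
  have SV: "S v \<in> V" if "v \<in> V" for v
    unfolding S_def using inV that V
    by (intro fun_space.subspace_sum fun_space.subspace_scale)
  have EV: "E v \<in> V" if "v \<in> V" for v
    unfolding ES using SV[OF that] V by (intro fun_space.subspace_scale)
  have lin_E: "linear_on V E"
    unfolding linear_on_def
  proof (intro conjI ballI allI)
    fix v w assume vw: "v \<in> V" "w \<in> V"
    have "\<rho> h (v + w) = \<rho> h v + \<rho> h w" if "h \<in> H" for h
      using lin[OF that] vw unfolding linear_on_def by blast
    then show "E (v + w) = E v + E w"
      unfolding E_def by (simp add: fun_space.scale_right_distrib sum.distrib)
  next
    fix c v assume v: "v \<in> V"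
    have "\<rho> h (scale_fun c v) = scale_fun c (\<rho> h v)" if "h \<in> H" for h
      using lin[OF that] v unfolding linear_on_def by blast
    then show "E (scale_fun c v) = scale_fun c (E v)"
      unfolding E_def by (simp add: fun_space.scale_sum_right mult.commute)
  qed
  have absorb: "scale_fun (\<epsilon> k) (\<rho> k (E v)) = E v" if k: "k \<in> H" and v: "v \<in> V" for k v
  proof -
    have "\<rho> k (E v) = (\<Sum>h\<in>H. \<rho> k (scale_fun (\<epsilon> h / N) (\<rho> h v)))"
      unfolding E_def by (rule linear_on_sum[OF V lin[OF k]])
        (use inV v fun_space.subspace_scale[OF V] in blast)
    also have "\<dots> = (\<Sum>h\<in>H. scale_fun (\<epsilon> h / N) (\<rho> (k \<otimes>\<^bsub>G\<^esub> h) v))"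
      using lin[OF k] inV v hom k unfolding linear_on_def by (intro sum.cong) auto
    finally have "scale_fun (\<epsilon> k) (\<rho> k (E v)) =
        (\<Sum>h\<in>H. scale_fun (\<epsilon> (k \<otimes>\<^bsub>G\<^esub> h) / N) (\<rho> (k \<otimes>\<^bsub>G\<^esub> h) v))"
      using \<epsilon> k by (simp add: fun_space.scale_sum_right)
    also have "\<dots> = E v"
      unfolding E_def
      by (rule sum.reindex_bij_witness[of _ "\<lambda>h. inv\<^bsub>G\<^esub> k \<otimes>\<^bsub>G\<^esub> h" "\<lambda>h. k \<otimes>\<^bsub>G\<^esub> h"])
        (use k in \<open>auto simp: m_assoc[symmetric]\<close>)
    finally show ?thesis .
  qed
  have fixed: "E v = v" if v: "\<forall>h\<in>H. scale_fun (\<epsilon> h) (\<rho> h v) = v" for v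
  proof -
    have "S v = (\<Sum>h\<in>H. v)" unfolding S_def using v by (intro sum.cong) auto
    also have "\<dots> = scale_fun N v" unfolding N_def by (rule fun_space.sum_constant_scale)
    finally show ?thesis using N0 by (simp add: ES)
  qed
  have idem: "E (E v) = E v" if "v \<in> V" for v
    using absorb that by (intro fixed ballI)
  have "E ` V \<subseteq> V" using EV by (rule image_subsetI)
  from trace_on_idempotent[OF V F lin_E this idem]
  obtain m :: nat where m: "trace_on V E = of_nat m"
      "(\<exists>v\<in>V. v \<noteq> 0 \<and> E v = v) \<longrightarrow> m > 0"
    by auto
  have "trace_on V E = (\<Sum>h\<in>H. \<epsilon> h / N * trace_on V (\<rho> h))"
    unfolding E_def[abs_def]
    by (rule trace_on_linear_combination[OF V F, where H = H and \<rho> = \<rho> and c = "\<lambda>h. \<epsilon> h / N"])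
      (rule inV)
  also have "\<dots> = (\<Sum>h\<in>H. \<epsilon> h * rep_char V \<rho> h) / N"
    unfolding rep_char_def by (simp add: sum_divide_distrib)
  finally have "(\<Sum>h\<in>H. \<epsilon> h * rep_char V \<rho> h) = N * of_nat m"
    using m(1) N0 by (simp add: field_simps)
  moreover have "(\<exists>v\<in>V. v \<noteq> 0 \<and> (\<forall>h\<in>H. scale_fun (\<epsilon> h) (\<rho> h v) = v)) \<longrightarrow> m > 0"
    using m(2) fixed by metis
  ultimately show ?thesis unfolding N_def by (intro exI[of _ m] conjI)
qed

section \<open>Commuting involutions and Sylow 2-subgroups\<close>

lemma even_card_involution_fixed_points:
  assumes X: "finite X" and f: "\<And>x. x \<in> X \<Longrightarrow> f x \<in> X" "\<And>x. x \<in> X \<Longrightarrow> f (f x) = x"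
  shows "even (card X) \<longleftrightarrow> even (card {x \<in> X. f x = x})"
proof -
  let ?M = "{x \<in> X. f x \<noteq> x}" and ?C = "(\<lambda>x. {x, f x}) ` {x \<in> X. f x \<noteq> x}"
  have U: "\<Union>?C = ?M" using f by force
  have "2 * card ?C = card (\<Union>?C)"
  proof (rule card_partition)
    show "finite ?C" "finite (\<Union>?C)" using X U by auto
    show "card c = 2" if "c \<in> ?C" for c using that by (auto simp: card_insert_if)
    have pair: "c = {z, f z}" if "c \<in> ?C" "z \<in> c" for c z
      using that f(2) by auto
    show "c1 \<inter> c2 = {}" if c: "c1 \<in> ?C" "c2 \<in> ?C" "c1 \<noteq> c2" for c1 c2
    proof (rule ccontr)
      assume "c1 \<inter> c2 \<noteq> {}"
      then obtain z where z: "z \<in> c1" "z \<in> c2" by auto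
      show False using pair[OF c(1) z(1)] pair[OF c(2) z(2)] c(3) by simp
    qed
  qed
  then have "2 * card ?C = card ?M" by (simp only: U)
  then have "even (card ?M)" by (rule dvdI[OF sym])
  moreover have "card X = card {x \<in> X. f x = x} + card ?M"
    using X by (subst card_Un_disjoint[symmetric]) (auto intro: arg_cong[where f = card])
  ultimately show ?thesis by simp
qed

text \<open>The fixed points of one involution are permuted by every involution commuting with it, and
  their number stays odd, so the involutions can be treated one after the other.\<close>

lemma odd_card_common_fixed_points:
  assumes I: "finite I" and X: "finite X" "odd (card X)"
    and f: "\<And>i x. i \<in> I \<Longrightarrow> x \<in> X \<Longrightarrow> f i x \<in> X"
      "\<And>i x. i \<in> I \<Longrightarrow> x \<in> X \<Longrightarrow> f i (f i x) = x"
      "\<And>i j x. i \<in> I \<Longrightarrow> j \<in> I \<Longrightarrow> x \<in> X \<Longrightarrow> f i (f j x) = f j (f i x)"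
  shows "odd (card {x \<in> X. \<forall>i\<in>I. f i x = x})"
  using I f
proof (induction I rule: finite_induct)
  case empty
  then show ?case using X by simp
next
  case (insert i I)
  let ?Y = "{x \<in> X. \<forall>i\<in>I. f i x = x}"
  have "odd (card ?Y)" using insert.prems by (intro insert.IH) auto
  moreover have "even (card ?Y) \<longleftrightarrow> even (card {x \<in> ?Y. f i x = x})"
  proof (rule even_card_involution_fixed_points)
    show "finite ?Y" using X by simp
    show "f i x \<in> ?Y" if "x \<in> ?Y" for x
      using that insert.prems(1) insert.prems(3)[of _ i x] by auto
    show "f i (f i x) = x" if "x \<in> ?Y" for x using that insert.prems(2) by auto
  qed
  moreover have "{x \<in> ?Y. f i x = x} = {x \<in> X. \<forall>j\<in>insert i I. f j x = x}" by auto
  ultimately show ?case by simp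
qed

text \<open>A Sylow 2-subgroup has an odd number of cosets, on which the involutions act by translation;
  a common fixed coset provides the conjugating element.\<close>

lemma commuting_involutions_conjugate_into_sylow:
  fixes \<tau> :: "'i \<Rightarrow> 'g"
  assumes G: "group G" "finite (carrier G)" and P: "sylow_subgroup 2 P G"
    and I: "finite I" and \<tau>: "\<And>i. i \<in> I \<Longrightarrow> \<tau> i \<in> carrier G"
      "\<And>i. i \<in> I \<Longrightarrow> \<tau> i \<otimes>\<^bsub>G\<^esub> \<tau> i = \<one>\<^bsub>G\<^esub>"
      "\<And>i j. i \<in> I \<Longrightarrow> j \<in> I \<Longrightarrow> \<tau> i \<otimes>\<^bsub>G\<^esub> \<tau> j = \<tau> j \<otimes>\<^bsub>G\<^esub> \<tau> i"
  shows "\<exists>a\<in>carrier G. \<forall>i\<in>I. a \<otimes>\<^bsub>G\<^esub> \<tau> i \<otimes>\<^bsub>G\<^esub> inv\<^bsub>G\<^esub> a \<in> P"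
proof -
  interpret group G by fact
  have sub: "subgroup P G" and cP: "card P = 2 ^ multiplicity 2 (order G)"
    using P unfolding sylow_subgroup_def by auto
  have PG: "P \<subseteq> carrier G" using sub by (rule subgroup.subset)
  let ?X = "rcosets\<^bsub>G\<^esub> P"
  have lag: "card ?X * card P = order G" using lagrange_finite[OF G(2) sub] .
  have ord: "order G \<noteq> 0" using G(2) order_gt_0_iff_finite by auto
  have "odd (card ?X)"
  proof
    assume "even (card ?X)"
    then obtain c where "card ?X = 2 * c" by auto
    then have "2 ^ Suc (multiplicity 2 (order G)) dvd order G"
      using lag cP by (metis dvd_triv_right mult.assoc mult.commute power_Suc)
    then have "Suc (multiplicity 2 (order G)) \<le> multiplicity 2 (order G)"
      using ord by (intro multiplicity_geI) auto
    then show False by simp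
  qed
  moreover have finX: "finite ?X"
    using rcosets_subset_PowG[OF sub] G(2) finite_subset by blast
  moreover have XG: "M \<subseteq> carrier G" if "M \<in> ?X" for M
    using rcosets_subset_PowG[OF sub] that by blast
  ultimately have "odd (card {M \<in> ?X. \<forall>i\<in>I. M #>\<^bsub>G\<^esub> \<tau> i = M})"
    using I
  proof (intro odd_card_common_fixed_points)
    fix i M assume i: "i \<in> I" and M: "M \<in> ?X"
    obtain a where "a \<in> carrier G" "M = P #>\<^bsub>G\<^esub> a" using M unfolding RCOSETS_def by auto
    then show "M #>\<^bsub>G\<^esub> \<tau> i \<in> ?X"
      using \<tau>(1)[OF i] PG by (simp add: coset_mult_assoc rcosetsI)
    show "M #>\<^bsub>G\<^esub> \<tau> i #>\<^bsub>G\<^esub> \<tau> i = M"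
      using XG[OF M] \<tau>[OF i] by (simp add: coset_mult_assoc coset_mult_one)
    fix j assume j: "j \<in> I"
    show "M #>\<^bsub>G\<^esub> \<tau> j #>\<^bsub>G\<^esub> \<tau> i = M #>\<^bsub>G\<^esub> \<tau> i #>\<^bsub>G\<^esub> \<tau> j"
      using XG[OF M] \<tau>(1)[OF i] \<tau>(1)[OF j] \<tau>(3)[OF i j] by (simp add: coset_mult_assoc)
  qed auto
  then have "{M \<in> ?X. \<forall>i\<in>I. M #>\<^bsub>G\<^esub> \<tau> i = M} \<noteq> {}"
    by (metis card.empty even_zero)
  then obtain M where M: "M \<in> ?X" "\<forall>i\<in>I. M #>\<^bsub>G\<^esub> \<tau> i = M" by auto
  then obtain a where a: "a \<in> carrier G" "M = P #>\<^bsub>G\<^esub> a" unfolding RCOSETS_def by auto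
  have "a \<otimes>\<^bsub>G\<^esub> \<tau> i \<otimes>\<^bsub>G\<^esub> inv\<^bsub>G\<^esub> a \<in> P" if i: "i \<in> I" for i
  proof (rule coset_join1[OF _ _ sub])
    have "P #>\<^bsub>G\<^esub> (a \<otimes>\<^bsub>G\<^esub> \<tau> i) = P #>\<^bsub>G\<^esub> a"
      using M(2) a i \<tau>(1)[OF i] PG by (metis coset_mult_assoc)
    then show "P #>\<^bsub>G\<^esub> (a \<otimes>\<^bsub>G\<^esub> \<tau> i \<otimes>\<^bsub>G\<^esub> inv\<^bsub>G\<^esub> a) = P"
      using a(1) \<tau>(1)[OF i] PG by (intro coset_mult_inv2) auto
    show "a \<otimes>\<^bsub>G\<^esub> \<tau> i \<otimes>\<^bsub>G\<^esub> inv\<^bsub>G\<^esub> a \<in> carrier G" using a(1) \<tau>(1)[OF i] by simp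
  qed
  with a(1) show ?thesis by blast
qed

section \<open>Specht modules as representations of the symmetric group\<close>

lemma diagram_eq_Sigma: "diagram \<mu> = (SIGMA i:{..<length \<mu>}. {..<\<mu> ! i})"
  unfolding diagram_def by auto

lemma card_diagram: "card (diagram \<mu>) = sum_list \<mu>"
  by (simp add: diagram_eq_Sigma sum_list_sum_nth atLeast0LessThan)

lemma tableaux_nonempty: "tableaux \<mu> \<noteq> {}"
proof -
  have "finite (diagram \<mu>)" by (simp add: diagram_eq_Sigma)
  then obtain t where "bij_betw t (diagram \<mu>) {1..sum_list \<mu>}"
    using finite_same_card_bij[of "diagram \<mu>" "{1..sum_list \<mu>}"] card_diagram by auto
  then show ?thesis unfolding tableaux_def by blast
qed

lemma row_entries_comp: "row_entries \<mu> (\<sigma> \<circ> t) = (\<lambda>i. \<sigma> ` row_entries \<mu> t i)"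
  unfolding row_entries_def by (simp add: image_comp)

lemma col_entries_comp: "col_entries \<mu> (\<sigma> \<circ> t) j = \<sigma> ` col_entries \<mu> t j"
  unfolding col_entries_def by (simp add: image_comp)

lemma comp_in_tableaux:
  assumes "t \<in> tableaux \<mu>" "\<sigma> permutes {1..sum_list \<mu>}"
  shows "\<sigma> \<circ> t \<in> tableaux \<mu>"
  using assms bij_betw_trans permutes_imp_bij unfolding tableaux_def by blast

lemma linear_on_perm_act: "linear_on V (perm_act \<sigma>)"
  unfolding linear_on_def perm_act_def scale_fun_def by (auto simp: fun_eq_iff)

lemma perm_act_comp:
  assumes "bij \<sigma>" "bij \<tau>"
  shows "perm_act (\<sigma> \<circ> \<tau>) f = perm_act \<sigma> (perm_act \<tau> f)"
  using assms unfolding perm_act_def by (simp add: o_inv_distrib image_comp)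

lemma perm_act_tabloid_vec:
  assumes "bij \<sigma>"
  shows "perm_act \<sigma> (tabloid_vec T) = tabloid_vec (\<lambda>i. \<sigma> ` T i)"
proof -
  have i: "inj \<sigma>" and s: "surj \<sigma>" using assms bij_is_inj bij_is_surj by blast+
  have "(\<lambda>i. inv' \<sigma> ` X i) = T \<longleftrightarrow> X = (\<lambda>i. \<sigma> ` T i)" for X
  proof
    assume "(\<lambda>i. inv' \<sigma> ` X i) = T"
    then have "T i = inv' \<sigma> ` X i" for i by auto
    then show "X = (\<lambda>i. \<sigma> ` T i)" using s by (simp add: image_f_inv_f)
  qed (use i in \<open>simp add: image_inv_f_f\<close>)
  then show ?thesis unfolding perm_act_def tabloid_vec_def by auto
qed

lemma perm_act_polytabloid_expand:
  assumes "bij \<sigma>"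
  shows "perm_act \<sigma> (polytabloid \<mu> t) = (\<Sum>\<pi>\<in>column_stabilizer \<mu> t.
           scale_fun (of_int (sign \<pi>)) (tabloid_vec (row_entries \<mu> (\<sigma> \<circ> \<pi> \<circ> t))))"
proof -
  have "perm_act \<sigma> (polytabloid \<mu> t) = (\<Sum>\<pi>\<in>column_stabilizer \<mu> t.
      perm_act \<sigma> (scale_fun (of_int (sign \<pi>)) (tabloid_vec (row_entries \<mu> (\<pi> \<circ> t)))))"
    unfolding polytabloid_def
    by (rule linear_on_sum[OF fun_space.subspace_UNIV linear_on_perm_act]) simp
  also have "\<dots> = (\<Sum>\<pi>\<in>column_stabilizer \<mu> t.
      scale_fun (of_int (sign \<pi>)) (perm_act \<sigma> (tabloid_vec (row_entries \<mu> (\<pi> \<circ> t)))))"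
    using linear_on_perm_act[of UNIV \<sigma>] unfolding linear_on_def by (intro sum.cong) auto
  finally show ?thesis
    by (simp add: perm_act_tabloid_vec[OF assms] row_entries_comp image_comp)
qed

lemma column_stabilizerD:
  assumes "\<pi> \<in> column_stabilizer \<mu> t"
  shows "\<pi> permutes {1..sum_list \<mu>}" "\<pi> ` col_entries \<mu> t j = col_entries \<mu> t j"
  using assms unfolding column_stabilizer_def by auto

lemma column_stabilizer_comp:
  assumes "\<pi> \<in> column_stabilizer \<mu> t" "\<rho> \<in> column_stabilizer \<mu> t"
  shows "\<pi> \<circ> \<rho> \<in> column_stabilizer \<mu> t"
proof -
  have "(\<pi> \<circ> \<rho>) ` col_entries \<mu> t j = col_entries \<mu> t j" for j
    using column_stabilizerD(2)[OF assms(1)] column_stabilizerD(2)[OF assms(2)]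
    by (simp only: image_comp[symmetric])
  then show ?thesis
    unfolding column_stabilizer_def
    using permutes_compose[OF column_stabilizerD(1)[OF assms(2)] column_stabilizerD(1)[OF assms(1)]]
    by (intro CollectI conjI allI)
qed

lemma column_stabilizer_inv:
  assumes "\<pi> \<in> column_stabilizer \<mu> t"
  shows "inv' \<pi> \<in> column_stabilizer \<mu> t"
proof -
  note \<pi> = column_stabilizerD[OF assms]
  have "inv' \<pi> ` col_entries \<mu> t j = inv' \<pi> ` (\<pi> ` col_entries \<mu> t j)" for j
    using \<pi>(2) by simp
  then have "inv' \<pi> ` col_entries \<mu> t j = col_entries \<mu> t j" for j
    using image_inv_f_f[OF permutes_inj[OF \<pi>(1)]] by simp
  then show ?thesis
    using permutes_inv[OF \<pi>(1)] unfolding column_stabilizer_def by simp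
qed

lemma column_stabilizer_conjugate:
  assumes \<sigma>: "\<sigma> permutes {1..sum_list \<mu>}" and \<pi>: "\<pi> \<in> column_stabilizer \<mu> t"
  shows "\<sigma> \<circ> \<pi> \<circ> inv' \<sigma> \<in> column_stabilizer \<mu> (\<sigma> \<circ> t)"
proof -
  have "(\<sigma> \<circ> \<pi> \<circ> inv' \<sigma>) ` (\<sigma> ` A) = \<sigma> ` (\<pi> ` A)" for A
    by (simp only: image_comp[symmetric] image_inv_f_f[OF permutes_inj[OF \<sigma>]])
  then show ?thesis
    using \<pi> \<sigma> unfolding column_stabilizer_def
    by (simp add: col_entries_comp permutes_compose permutes_inv)
qed

text \<open>Conjugation by \<open>\<sigma>\<close> carries the column stabilizer of \<open>t\<close> to that of \<open>\<sigma> \<circ> t\<close> and preserves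
  signs.\<close>

lemma perm_act_polytabloid:
  assumes \<sigma>: "\<sigma> permutes {1..sum_list \<mu>}"
  shows "perm_act \<sigma> (polytabloid \<mu> t) = polytabloid \<mu> (\<sigma> \<circ> t)"
proof -
  note b = permutes_bij[OF \<sigma>] and \<sigma>i = permutes_inv[OF \<sigma>]
  have undo_o: "inv' \<sigma> \<circ> \<sigma> = id" "\<sigma> \<circ> inv' \<sigma> = id"
    using permutes_inv_o[OF \<sigma>] by auto
  have undo: "inv' \<sigma> (\<sigma> x) = x" "\<sigma> (inv' \<sigma> x) = x" for x
    using permutes_inverses[OF \<sigma>] by auto
  have conj_back: "inv' \<sigma> \<circ> \<pi> \<circ> \<sigma> \<in> column_stabilizer \<mu> t" if "\<pi> \<in> column_stabilizer \<mu> (\<sigma> \<circ> t)" for \<pi>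
    using column_stabilizer_conjugate[OF \<sigma>i that] b
    by (simp add: comp_assoc[symmetric] undo_o(1) inv_inv_eq)
  have sgn: "sign (\<sigma> \<circ> \<pi> \<circ> inv' \<sigma>) = sign \<pi>" if "\<pi> \<in> column_stabilizer \<mu> t" for \<pi>
  proof -
    have "permutation \<pi>" "permutation \<sigma>"
      using column_stabilizerD(1)[OF that] \<sigma> permutes_imp_permutation by blast+
    moreover have "sign \<sigma> * sign \<sigma> = 1" by (simp add: sign_def)
    ultimately show ?thesis
      by (simp add: sign_compose sign_inverse permutation_compose permutation_inverse)
  qed
  show ?thesis
    unfolding perm_act_polytabloid_expand[OF b]
    unfolding polytabloid_def
  proof (rule sum.reindex_bij_witness[of _ "\<lambda>\<pi>. inv' \<sigma> \<circ> \<pi> \<circ> \<sigma>" "\<lambda>\<pi>. \<sigma> \<circ> \<pi> \<circ> inv' \<sigma>"])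
    fix \<pi> assume \<pi>: "\<pi> \<in> column_stabilizer \<mu> t"
    have "\<sigma> \<circ> \<pi> \<circ> inv' \<sigma> \<circ> (\<sigma> \<circ> t) = \<sigma> \<circ> \<pi> \<circ> t" by (simp add: fun_eq_iff undo)
    then show "scale_fun (of_int (sign (\<sigma> \<circ> \<pi> \<circ> inv' \<sigma>)))
          (tabloid_vec (row_entries \<mu> (\<sigma> \<circ> \<pi> \<circ> inv' \<sigma> \<circ> (\<sigma> \<circ> t)))) =
        scale_fun (of_int (sign \<pi>)) (tabloid_vec (row_entries \<mu> (\<sigma> \<circ> \<pi> \<circ> t)))"
      by (simp only: sgn[OF \<pi>])
    show "\<sigma> \<circ> \<pi> \<circ> inv' \<sigma> \<in> column_stabilizer \<mu> (\<sigma> \<circ> t)"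
      by (rule column_stabilizer_conjugate[OF \<sigma> \<pi>])
    show "inv' \<sigma> \<circ> (\<sigma> \<circ> \<pi> \<circ> inv' \<sigma>) \<circ> \<sigma> = \<pi>" by (rule ext) (simp add: undo)
  next
    fix \<pi> assume "\<pi> \<in> column_stabilizer \<mu> (\<sigma> \<circ> t)"
    then show "inv' \<sigma> \<circ> \<pi> \<circ> \<sigma> \<in> column_stabilizer \<mu> t" by (rule conj_back)
    show "\<sigma> \<circ> (inv' \<sigma> \<circ> \<pi> \<circ> \<sigma>) \<circ> inv' \<sigma> = \<pi>" by (rule ext) (simp add: undo)
  qed
qed

text \<open>The column stabilizer is a group, so \<open>\<pi> \<mapsto> \<sigma> \<circ> \<pi>\<close> permutes the terms of the polytabloid and
  changes each sign by the sign of \<open>\<sigma>\<close>.\<close>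

lemma perm_act_polytabloid_column_stabilizer:
  assumes \<sigma>: "\<sigma> \<in> column_stabilizer \<mu> t"
  shows "perm_act \<sigma> (polytabloid \<mu> t) = scale_fun (of_int (sign \<sigma>)) (polytabloid \<mu> t)"
proof -
  note \<sigma>p = column_stabilizerD(1)[OF \<sigma>]
  have undo: "inv' \<sigma> (\<sigma> x) = x" "\<sigma> (inv' \<sigma> x) = x" for x
    using permutes_inverses[OF \<sigma>p] by auto
  have sgn: "sign \<sigma> * sign (\<sigma> \<circ> \<pi>) = sign \<pi>" if "\<pi> \<in> column_stabilizer \<mu> t" for \<pi>
  proof -
    have "permutation \<pi>" "permutation \<sigma>"
      using column_stabilizerD(1)[OF that] \<sigma>p permutes_imp_permutation by blast+
    moreover have "sign \<sigma> * sign \<sigma> = 1" by (simp add: sign_def)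
    ultimately show ?thesis by (simp add: sign_compose mult.assoc[symmetric])
  qed
  have "perm_act \<sigma> (polytabloid \<mu> t) = (\<Sum>\<pi>\<in>column_stabilizer \<mu> t.
      scale_fun (of_int (sign \<sigma> * sign \<pi>)) (tabloid_vec (row_entries \<mu> (\<pi> \<circ> t))))"
    unfolding perm_act_polytabloid_expand[OF permutes_bij[OF \<sigma>p]]
  proof (rule sum.reindex_bij_witness[of _ "\<lambda>\<pi>. inv' \<sigma> \<circ> \<pi>" "\<lambda>\<pi>. \<sigma> \<circ> \<pi>"])
    fix \<pi> assume \<pi>: "\<pi> \<in> column_stabilizer \<mu> t"
    show "scale_fun (of_int (sign \<sigma> * sign (\<sigma> \<circ> \<pi>)))
          (tabloid_vec (row_entries \<mu> (\<sigma> \<circ> \<pi> \<circ> t))) =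
        scale_fun (of_int (sign \<pi>)) (tabloid_vec (row_entries \<mu> (\<sigma> \<circ> \<pi> \<circ> t)))"
      by (simp only: sgn[OF \<pi>])
    show "\<sigma> \<circ> \<pi> \<in> column_stabilizer \<mu> t" "inv' \<sigma> \<circ> \<pi> \<in> column_stabilizer \<mu> t"
      using column_stabilizer_comp column_stabilizer_inv \<sigma> \<pi> by blast+
    show "inv' \<sigma> \<circ> (\<sigma> \<circ> \<pi>) = \<pi>" "\<sigma> \<circ> (inv' \<sigma> \<circ> \<pi>) = \<pi>"
      by (rule ext, simp add: undo)+
  qed
  then show ?thesis
    unfolding polytabloid_def by (simp add: fun_space.scale_sum_right)
qed

text \<open>A permutation that preserves all rows and all columns of \<open>t\<close> is the identity, so the tabloid
  of \<open>t\<close> itself has coefficient 1 in the polytabloid.\<close>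

lemma polytabloid_nonzero:
  assumes t: "t \<in> tableaux \<mu>"
  shows "polytabloid \<mu> t \<noteq> 0"
proof -
  let ?C = "column_stabilizer \<mu> t"
  have inj: "inj_on t (diagram \<mu>)" and im: "t ` diagram \<mu> = {1..sum_list \<mu>}"
    using t unfolding tableaux_def bij_betw_def by auto
  have fin: "finite ?C"
    by (rule finite_subset[OF _ finite_permutations[of "{1..sum_list \<mu>}"]])
      (auto simp: column_stabilizer_def)
  have id: "id \<in> ?C" unfolding column_stabilizer_def by (simp add: permutes_id)
  have only: "\<pi> = id" if \<pi>: "\<pi> \<in> ?C" and row: "row_entries \<mu> (\<pi> \<circ> t) = row_entries \<mu> t" for \<pi>
  proof
    fix x
    show "\<pi> x = id x"
    proof (cases "x \<in> {1..sum_list \<mu>}")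
      case False
      then show ?thesis using column_stabilizerD(1)[OF \<pi>] by (simp add: permutes_not_in)
    next
      case True
      then obtain i j where c: "(i, j) \<in> diagram \<mu>" "x = t (i, j)" using im by force
      have "\<pi> x \<in> row_entries \<mu> (\<pi> \<circ> t) i"
        using c unfolding row_entries_def by force
      then obtain j' where j': "(i, j') \<in> diagram \<mu>" "\<pi> x = t (i, j')"
        unfolding row row_entries_def by auto
      have "x \<in> col_entries \<mu> t j" using c unfolding col_entries_def by force
      then have "\<pi> x \<in> col_entries \<mu> t j" using column_stabilizerD(2)[OF \<pi>] by blast
      then obtain i' where i': "(i', j) \<in> diagram \<mu>" "\<pi> x = t (i', j)"
        unfolding col_entries_def by auto
      have "(i, j') = (i', j)" using inj j' i' by (metis inj_onD)
      then show ?thesis using j' c by simp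
    qed
  qed
  have eval: "(\<Sum>\<pi>\<in>A. f \<pi>) X = (\<Sum>\<pi>\<in>A. f \<pi> X)"
    for A and f :: "(nat \<Rightarrow> nat) \<Rightarrow> tabloid \<Rightarrow> complex" and X
    by (induction A rule: infinite_finite_induct) auto
  have "polytabloid \<mu> t (row_entries \<mu> t) =
      (\<Sum>\<pi>\<in>?C. if row_entries \<mu> t = row_entries \<mu> (\<pi> \<circ> t) then of_int (sign \<pi>) else 0)"
    unfolding polytabloid_def eval by (intro sum.cong) (auto simp: scale_fun_def tabloid_vec_def)
  also have "\<dots> = (\<Sum>\<pi>\<in>?C. if \<pi> = id then 1 else 0)"
    by (rule sum.cong[OF refl]) (use only in \<open>auto simp: sign_id\<close>)
  also have "\<dots> = 1" using fin id by simp
  finally show ?thesis by auto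
qed

text \<open>There may be infinitely many tableaux, since their values off the diagram are arbitrary. The
  dimension is finite because the polytabloids lie in the span of finitely many tabloids.\<close>

lemma specht_representation:
  "representation_of (sym_group (sum_list \<mu>)) (specht \<mu>) perm_act"
proof -
  let ?n = "sum_list \<mu>" and ?V = "specht \<mu>"
  have V: "fun_space.subspace ?V" unfolding specht_def by (rule fun_space.subspace_span)
  define F where "F = {T :: tabloid. \<forall>i. (i \<in> {..<length \<mu>} \<longrightarrow> T i \<in> Pow {1..?n}) \<and>
      (i \<notin> {..<length \<mu>} \<longrightarrow> T i = {})}"
  have F: "finite (tabloid_vec ` F)"
    unfolding F_def by (intro finite_imageI finite_set_of_finite_funs) auto
  have "polytabloid \<mu> t \<in> fun_space.span (tabloid_vec ` F)" if t: "t \<in> tableaux \<mu>" for t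
    unfolding polytabloid_def
  proof (intro fun_space.span_sum fun_space.span_scale fun_space.span_base imageI)
    fix \<pi> assume "\<pi> \<in> column_stabilizer \<mu> t"
    then have "\<pi> \<circ> t \<in> tableaux \<mu>" using comp_in_tableaux[OF t] column_stabilizerD(1) by blast
    then have "(\<pi> \<circ> t) ` diagram \<mu> = {1..?n}" unfolding tableaux_def bij_betw_def by blast
    then have "row_entries \<mu> (\<pi> \<circ> t) i \<subseteq> {1..?n}" for i unfolding row_entries_def by blast
    moreover have "row_entries \<mu> (\<pi> \<circ> t) i = {}" if "i \<ge> length \<mu>" for i
      using that unfolding row_entries_def diagram_def by auto
    ultimately show "row_entries \<mu> (\<pi> \<circ> t) \<in> F" unfolding F_def by simp
  qed
  then have VF: "?V \<subseteq> fun_space.span (tabloid_vec ` F)"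
    unfolding specht_def by (intro fun_space.span_minimal fun_space.subspace_span) blast
  obtain B where B: "B \<subseteq> ?V" "fun_space.independent B" "?V \<subseteq> fun_space.span B"
    using fun_space.maximal_independent_subset by blast
  have "finite B" by (rule finite_independent_of_finite_span[OF F VF B(2,1)])
  moreover have "fun_space.span B = ?V" using B fun_space.span_minimal[OF _ V] by blast
  ultimately have fin: "\<exists>B. finite B \<and> fun_space.span B = ?V" by blast
  have maps: "perm_act \<sigma> ` ?V \<subseteq> ?V" if \<sigma>: "\<sigma> permutes {1..?n}" for \<sigma>
  proof -
    have "fun_space.subspace {v. perm_act \<sigma> v \<in> ?V}"
      using linear_on_perm_act[of UNIV \<sigma>] V
      unfolding linear_on_def fun_space.subspace_def by (auto simp: perm_act_def zero_fun_def)
    moreover have "polytabloid \<mu> ` tableaux \<mu> \<subseteq> {v. perm_act \<sigma> v \<in> ?V}"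
      using perm_act_polytabloid[OF \<sigma>] comp_in_tableaux[OF _ \<sigma>]
      unfolding specht_def by (auto intro: fun_space.span_base)
    ultimately have "?V \<subseteq> {v. perm_act \<sigma> v \<in> ?V}"
      using fun_space.span_minimal unfolding specht_def by blast
    then show ?thesis by blast
  qed
  show ?thesis
    unfolding representation_of_def sym_group_mult sym_group_one
  proof (intro conjI ballI)
    show "perm_act (g \<circ> h) v = perm_act g (perm_act h v)"
      if "g \<in> carrier (sym_group ?n)" "h \<in> carrier (sym_group ?n)" for g h v
      using that by (intro perm_act_comp) (auto simp: sym_group_carrier dest: permutes_bij)
    show "perm_act id v = v" for v by (simp add: perm_act_def)
  qed (use V fin maps linear_on_perm_act in \<open>simp_all add: sym_group_carrier\<close>)
qed

text \<open>Every row meets the first column in one cell, because the parts of a partition are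
  positive.\<close>

lemma card_first_column:
  assumes \<mu>: "\<mu> \<in> partitions n" and t: "t \<in> tableaux \<mu>"
  shows "card (col_entries \<mu> t 0) = length \<mu>"
proof -
  have "{c \<in> diagram \<mu>. snd c = 0} = (\<lambda>i. (i, 0)) ` {..<length \<mu>}"
    using \<mu> unfolding partitions_def diagram_def by (auto simp: in_set_conv_nth)
  moreover have "inj_on t {c \<in> diagram \<mu>. snd c = 0}"
    using t unfolding tableaux_def bij_betw_def by (auto intro: inj_on_subset)
  ultimately show ?thesis
    unfolding col_entries_def by (simp add: card_image inj_on_def)
qed

lemma permutes_column_in_column_stabilizer:
  assumes t: "t \<in> tableaux \<mu>" and \<pi>: "\<pi> permutes col_entries \<mu> t k"
  shows "\<pi> \<in> column_stabilizer \<mu> t"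
proof -
  have inj: "inj_on t (diagram \<mu>)" and im: "t ` diagram \<mu> = {1..sum_list \<mu>}"
    using t unfolding tableaux_def bij_betw_def by auto
  have "col_entries \<mu> t k \<subseteq> {1..sum_list \<mu>}" using im unfolding col_entries_def by blast
  then have "\<pi> permutes {1..sum_list \<mu>}" using \<pi> permutes_subset by blast
  moreover have "\<pi> ` col_entries \<mu> t j = col_entries \<mu> t j" for j
  proof (cases "j = k")
    case False
    then have "x \<notin> col_entries \<mu> t k" if "x \<in> col_entries \<mu> t j" for x
      using that inj unfolding col_entries_def by (auto dest: inj_onD)
    then have "\<pi> x = x" if "x \<in> col_entries \<mu> t j" for x
      using that \<pi> permutes_not_in by metis
    then show ?thesis by simp
  qed (use permutes_image[OF \<pi>] in simp)
  ultimately show ?thesis unfolding column_stabilizer_def by blast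
qed

section \<open>Sign sums over the conjugates of a Sylow 2-subgroup\<close>

lemma transpose_conjugate:
  assumes "bij f"
  shows "f \<circ> transpose a b \<circ> inv' f = transpose (f a) (f b)"
proof
  fix x
  obtain y where y: "x = f y" using assms by (metis bij_pointE)
  have "inj f" using assms by (rule bij_is_inj)
  then show "(f \<circ> transpose a b \<circ> inv' f) x = transpose (f a) (f b) x"
    by (auto simp: y transpose_def inj_eq)
qed

text \<open>Some conjugate of \<open>P\<close> contains the disjoint transpositions \<open>(1 2), (3 4), \<dots>\<close>, hence so does
  every conjugate up to renaming the points. The supports of these transpositions, together with
  the point left over if \<open>n\<close> is odd, split \<open>{1..n}\<close> into \<open>(n + 1) div 2\<close> classes, so a larger set
  contains two points of one class.\<close>

lemma sylow_conjugate_contains_transposition: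
  assumes P: "sylow_subgroup 2 P (sym_group n)" and x: "x permutes {1..n}"
    and C: "C \<subseteq> {1..n}" "card C > (n + 1) div 2"
  shows "\<exists>c\<in>C. \<exists>d\<in>C. c \<noteq> d \<and> inv' x \<circ> transpose c d \<circ> x \<in> P"
proof -
  define \<tau> :: "nat \<Rightarrow> nat \<Rightarrow> nat" where "\<tau> i = transpose (2 * i + 1) (2 * i + 2)" for i
  have \<tau>: "\<tau> i permutes {1..n}" if "i < n div 2" for i
    unfolding \<tau>_def using that by (intro permutes_swap_id) auto
  have comm: "\<tau> i \<circ> \<tau> j = \<tau> j \<circ> \<tau> i" for i j
  proof (cases "i = j")
    case False
    then have "2 * i + 1 \<noteq> 2 * j + 2" "2 * i + 2 \<noteq> 2 * j + 1" by presburger+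
    with False show ?thesis unfolding \<tau>_def by (auto simp: fun_eq_iff transpose_def)
  qed simp
  have "\<exists>a\<in>carrier (sym_group n). \<forall>i\<in>{..<n div 2}.
      a \<otimes>\<^bsub>sym_group n\<^esub> \<tau> i \<otimes>\<^bsub>sym_group n\<^esub> inv\<^bsub>sym_group n\<^esub> a \<in> P"
  proof (rule commuting_involutions_conjugate_into_sylow[OF sym_group_is_group _ P])
    show "finite (carrier (sym_group n))"
      unfolding sym_group_def by (simp add: finite_permutations)
    show "\<tau> i \<otimes>\<^bsub>sym_group n\<^esub> \<tau> i = \<one>\<^bsub>sym_group n\<^esub>" for i
      unfolding sym_group_mult sym_group_one \<tau>_def by simp
  qed (use \<tau> comm in \<open>auto simp: sym_group_mult sym_group_carrier\<close>)
  then obtain a where a: "a permutes {1..n}" "\<And>i. i < n div 2 \<Longrightarrow> a \<circ> \<tau> i \<circ> inv' a \<in> P"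
    using sym_group_inv_equality[of _ n] by (auto simp: sym_group_carrier sym_group_mult)
  \<comment> \<open>Conjugation by \<open>y\<close> sends each \<open>\<tau> i\<close> into \<open>x P x\<^sup>-\<^sup>1\<close>, so the points are relabelled by \<open>y\<close>.\<close>
  define y where "y = x \<circ> a"
  have y: "y permutes {1..n}" unfolding y_def using a(1) x by (rule permutes_compose)
  define D where "D = inv' y ` C"
  have D: "D \<subseteq> {1..n}"
    unfolding D_def using C(1) permutes_image[OF permutes_inv[OF y]] by blast
  have cD: "card D = card C"
    unfolding D_def using permutes_inj[OF permutes_inv[OF y]] by (simp add: card_image inj_on_subset)
  have yD: "y m \<in> C" if "m \<in> D" for m
    using that permutes_inverses[OF y] unfolding D_def by auto
  let ?f = "\<lambda>m. (m - 1) div 2 :: nat"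
  have "?f ` D \<subseteq> {..<(n + 1) div 2}"
  proof (rule image_subsetI)
    fix m assume "m \<in> D"
    then have "1 \<le> m" "m \<le> n" using D by auto
    then have "(m - 1) div 2 < (n + 1) div 2" by presburger
    then show "(m - 1) div 2 \<in> {..<(n + 1) div 2}" by simp
  qed
  then have "card (?f ` D) \<le> (n + 1) div 2" using card_mono[of "{..<(n + 1) div 2}"] by simp
  then have "\<not> inj_on ?f D" using pigeonhole[of ?f D] C(2) cD by simp
  then obtain m m' where m: "m \<in> D" "m' \<in> D" "m < m'" "?f m = ?f m'"
    unfolding inj_on_def by (metis linorder_neq_iff)
  define i where "i = ?f m"
  have "m \<ge> 1" "m' \<le> n" using m D by auto
  moreover have "2 * i \<le> m - 1" "m - 1 < 2 * i + 2" unfolding i_def by presburger+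
  moreover have "2 * i \<le> m' - 1" "m' - 1 < 2 * i + 2" unfolding i_def m(4) by presburger+
  ultimately have i: "m = 2 * i + 1" "m' = 2 * i + 2" using m(3) by linarith+
  then have i_less: "i < n div 2" using \<open>m' \<le> n\<close> by linarith
  have "inv' x \<circ> transpose (y m) (y m') \<circ> x = inv' x \<circ> (y \<circ> \<tau> i \<circ> inv' y) \<circ> x"
    unfolding \<tau>_def i transpose_conjugate[OF permutes_bij[OF y]] ..
  also have "\<dots> = a \<circ> \<tau> i \<circ> inv' a"
    unfolding y_def o_inv_distrib[OF permutes_bij[OF x] permutes_bij[OF a(1)]]
    by (rule ext) (simp add: permutes_inverses[OF x])
  also have "\<dots> \<in> P" using a(2) i_less by blast
  finally have "inv' x \<circ> transpose (y m) (y m') \<circ> x \<in> P" .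
  moreover have "y m \<noteq> y m'" using m(3) permutes_inj[OF y] by (simp add: inj_eq)
  ultimately show ?thesis using yD m by blast
qed

text \<open>Composition with the transposition pairs even and odd elements.\<close>

lemma sum_sign_eq_0:
  assumes K: "\<And>\<pi>. \<pi> \<in> K \<Longrightarrow> permutation \<pi>"
    and cd: "c \<noteq> d" "\<And>\<pi>. \<pi> \<in> K \<Longrightarrow> transpose c d \<circ> \<pi> \<in> K"
  shows "(\<Sum>\<pi>\<in>K. of_int (sign \<pi>)) = (0 :: complex)"
proof -
  have "sign (transpose c d \<circ> \<pi>) = - sign \<pi>" if "\<pi> \<in> K" for \<pi>
    using K[OF that] cd(1) by (simp add: sign_compose sign_swap_id permutation_swap_id)
  then have "(\<Sum>\<pi>\<in>K. of_int (sign \<pi>)) = (\<Sum>\<pi>\<in>K. - of_int (sign \<pi>) :: complex)"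
    by (intro sum.reindex_bij_witness[of _ "\<lambda>\<pi>. transpose c d \<circ> \<pi>" "\<lambda>\<pi>. transpose c d \<circ> \<pi>"])
      (auto simp: cd(2) comp_assoc[symmetric])
  then show ?thesis by (simp add: sum_negf)
qed

text \<open>By the definition of the induced character the sum splits into sign sums over the subgroups
  of those permutations of \<open>C\<close> that lie in a given conjugate of \<open>P\<close>; each contains a
  transposition.\<close>

lemma sum_sign_induced_char_eq_0:
  assumes P: "sylow_subgroup 2 P (sym_group n)"
    and C: "C \<subseteq> {1..n}" "card C > (n + 1) div 2"
  shows "(\<Sum>\<pi> | \<pi> permutes C. of_int (sign \<pi>) * induced_char (sym_group n) P (\<lambda>_. 1) \<pi>) = 0"
proof -
  let ?G = "sym_group n" and ?H = "{\<pi>. \<pi> permutes C}"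
  have finC: "finite C" using C(1) finite_subset by blast
  have sub: "subgroup P ?G" using P unfolding sylow_subgroup_def by blast
  have "(\<Sum>\<pi>\<in>?H. if inv' x \<circ> \<pi> \<circ> x \<in> P then of_int (sign \<pi>) else (0 :: complex)) = 0"
    if x: "x permutes {1..n}" for x
  proof -
    obtain c d where cd: "c \<in> C" "d \<in> C" "c \<noteq> d" "inv' x \<circ> transpose c d \<circ> x \<in> P"
      using sylow_conjugate_contains_transposition[OF P x C] by blast
    have "transpose c d \<circ> \<pi> \<in> {\<pi> \<in> ?H. inv' x \<circ> \<pi> \<circ> x \<in> P}"
      if \<pi>: "\<pi> \<in> {\<pi> \<in> ?H. inv' x \<circ> \<pi> \<circ> x \<in> P}" for \<pi>
    proof -
      have "transpose c d \<circ> \<pi> permutes C"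
        using \<pi> permutes_swap_id[OF cd(1,2)] permutes_compose by blast
      moreover have "(inv' x \<circ> transpose c d \<circ> x) \<circ> (inv' x \<circ> \<pi> \<circ> x) \<in> P"
        using subgroup.m_closed[OF sub cd(4)] \<pi> by (simp add: sym_group_mult)
      moreover have "(inv' x \<circ> transpose c d \<circ> x) \<circ> (inv' x \<circ> \<pi> \<circ> x) =
          inv' x \<circ> (transpose c d \<circ> \<pi>) \<circ> x"
        using permutes_inverses[OF x] by (simp add: fun_eq_iff)
      ultimately show ?thesis by simp
    qed
    then have "(\<Sum>\<pi>\<in>{\<pi> \<in> ?H. inv' x \<circ> \<pi> \<circ> x \<in> P}. of_int (sign \<pi>)) = (0 :: complex)"
      using cd(3) permutes_imp_permutation[OF finC] by (intro sum_sign_eq_0) auto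
    then show ?thesis
      by (rule trans[OF sum.inter_filter[OF finite_permutations[OF finC], symmetric]])
  qed
  note inner = this
  have "of_int (sign \<pi>) * induced_char ?G P (\<lambda>_. 1) \<pi> =
      (\<Sum>x\<in>carrier ?G. if inv' x \<circ> \<pi> \<circ> x \<in> P then of_int (sign \<pi>) else 0) / of_nat (card P)" for \<pi>
    unfolding induced_char_def times_divide_eq_right sum_distrib_left
    by (intro arg_cong2[where f = "(/)"] sum.cong) (auto simp: sym_group_mult)
  then have "(\<Sum>\<pi>\<in>?H. of_int (sign \<pi>) * induced_char ?G P (\<lambda>_. 1) \<pi>) =
      (\<Sum>\<pi>\<in>?H. \<Sum>x\<in>carrier ?G. if inv' x \<circ> \<pi> \<circ> x \<in> P then of_int (sign \<pi>) else 0) / of_nat (card P)"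
    by (simp add: sum_divide_distrib)
  also have "\<dots> = 0"
    by (subst sum.swap) (simp add: inner sym_group_carrier)
  finally show ?thesis .
qed

lemma permutes_subgroup_sym_group:
  assumes "C \<subseteq> {1..n}"
  shows "subgroup {\<pi>. \<pi> permutes C} (sym_group n)"
proof
  show "{\<pi>. \<pi> permutes C} \<subseteq> carrier (sym_group n)"
    using permutes_subset[OF _ assms] by (auto simp: sym_group_carrier)
  then show "inv\<^bsub>sym_group n\<^esub> \<pi> \<in> {\<pi>. \<pi> permutes C}" if "\<pi> \<in> {\<pi>. \<pi> permutes C}" for \<pi>
    using that permutes_inv by (subst sym_group_inv_equality) auto
qed (auto simp: sym_group_mult sym_group_one permutes_compose permutes_id)

section \<open>The bound on the number of parts\<close>

theorem proposition2p6:
  fixes n :: nat and P :: "(nat \<Rightarrow> nat) set" and \<mu> :: "nat list"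
  assumes "n > 0"
    and "sylow_subgroup 2 P (sym_group n)"
    and "\<mu> \<in> Omega2 n P"
  shows "int (length \<mu>) \<le> \<lceil>real n / 2\<rceil>"
proof (rule ccontr)
  assume "\<not> int (length \<mu>) \<le> \<lceil>real n / 2\<rceil>"
  then have len: "length \<mu> > (n + 1) div 2" by linarith
  let ?G = "sym_group n" and ?\<epsilon> = "\<lambda>\<pi>. of_int (sign \<pi>) :: complex"
  have \<mu>: "\<mu> \<in> partitions n" using assms(3) unfolding Omega2_def by blast
  then have n: "sum_list \<mu> = n" unfolding partitions_def by blast
  obtain \<theta> where \<theta>: "is_character ?G \<theta>"
      "\<forall>g\<in>carrier ?G. induced_char ?G P (\<lambda>_. 1) g = specht_char \<mu> g + \<theta> g"
    using assms(3) unfolding Omega2_def irreducible_constituent_def by blast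
  obtain V :: "(nat \<Rightarrow> complex) set" and \<rho> where V: "representation_of ?G V \<rho>"
      "\<forall>g\<in>carrier ?G. \<theta> g = rep_char V \<rho> g"
    using \<theta>(1) unfolding is_character_def by blast
  obtain t where t: "t \<in> tableaux \<mu>" using tableaux_nonempty by blast
  define C where "C = col_entries \<mu> t 0"
  define H where "H = {\<pi>. \<pi> permutes C}"
  have "t ` diagram \<mu> = {1..n}" using t n unfolding tableaux_def bij_betw_def by blast
  then have C: "C \<subseteq> {1..n}" unfolding C_def col_entries_def by blast
  have cC: "card C > (n + 1) div 2"
    unfolding C_def card_first_column[OF \<mu> t] by (rule len)
  have finC: "finite C" using C finite_subset by blast
  have H: "subgroup H ?G" "finite H"
    unfolding H_def using permutes_subgroup_sym_group[OF C] finite_permutations[OF finC] by auto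
  have hom: "?\<epsilon> (g \<otimes>\<^bsub>?G\<^esub> h) = ?\<epsilon> g * ?\<epsilon> h" if "g \<in> H" "h \<in> H" for g h
    using that permutes_imp_permutation[OF finC] unfolding H_def
    by (simp add: sym_group_mult sign_compose)
  have "scale_fun (?\<epsilon> h) (perm_act h (polytabloid \<mu> t)) = polytabloid \<mu> t" if "h \<in> H" for h
  proof -
    have "h \<in> column_stabilizer \<mu> t"
      using permutes_column_in_column_stabilizer[OF t] that unfolding H_def C_def by blast
    then have "scale_fun (?\<epsilon> h) (perm_act h (polytabloid \<mu> t)) =
        scale_fun (?\<epsilon> h * ?\<epsilon> h) (polytabloid \<mu> t)"
      by (simp add: perm_act_polytabloid_column_stabilizer)
    moreover have "?\<epsilon> h * ?\<epsilon> h = 1" by (simp add: sign_def)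
    ultimately show ?thesis by simp
  qed
  moreover have "polytabloid \<mu> t \<in> specht \<mu>"
    unfolding specht_def using t by (intro fun_space.span_base imageI)
  ultimately have "\<exists>v\<in>specht \<mu>. v \<noteq> 0 \<and> (\<forall>h\<in>H. scale_fun (?\<epsilon> h) (perm_act h v) = v)"
    using polytabloid_nonzero[OF t] by blast
  then obtain m :: nat where m: "m > 0"
      "(\<Sum>h\<in>H. ?\<epsilon> h * specht_char \<mu> h) = of_nat (card H) * of_nat m"
    using sum_twisted_character[OF specht_representation[of \<mu>, unfolded n] sym_group_is_group H,
        of ?\<epsilon>, OF hom]
    unfolding specht_char_def by blast
  obtain k :: nat where k: "(\<Sum>h\<in>H. ?\<epsilon> h * rep_char V \<rho> h) = of_nat (card H) * of_nat k"
    using sum_twisted_character[OF V(1) sym_group_is_group H, of ?\<epsilon>, OF hom] by blast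
  \<comment> \<open>The induced character vanishes on the signed sum, while its two summands contribute \<open>m > 0\<close>
    and \<open>k \<ge> 0\<close>.\<close>
  have "0 = (\<Sum>h\<in>H. ?\<epsilon> h * induced_char ?G P (\<lambda>_. 1) h)"
    unfolding H_def using sum_sign_induced_char_eq_0[OF assms(2) C cC] by simp
  also have "\<dots> = (\<Sum>h\<in>H. ?\<epsilon> h * specht_char \<mu> h + ?\<epsilon> h * rep_char V \<rho> h)"
    using \<theta>(2) V(2) subgroup.mem_carrier[OF H(1)]
    by (intro sum.cong) (auto simp: distrib_left)
  also have "\<dots> = of_nat (card H * (m + k))"
    by (simp add: sum.distrib m(2) k distrib_left)
  finally have "card H * (m + k) = 0" by (metis of_nat_0 of_nat_eq_iff)
  moreover have "card H > 0"
    using H(2) permutes_id card_gt_0_iff unfolding H_def by blast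
  ultimately show False using m(1) by simp
qed

end
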